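(* Let $\Omega=\bigcup_{i=1}^n(\alpha_i,\beta_i)$ be a finite union of finite open intervals as in the context, and suppose that $\Omega$ is spectral with associated boundary matrix $B$. (i) All gaps $\alpha_j-\beta_i>0$, $i\ne j$, are sums of lengths of intervals of $\Omega$: for all $i\neq j$ with $\alpha_j-\beta_i>0$ there is a finite sequence of indices $k_1,\dots,k_s\in\{1,\dots,n\}$ (repetitions allowed) with $\alpha_j-\beta_i=l_{k_1}+\dots+l_{k_s}$. (ii) Let $x\in(\alpha_i,\beta_i)$, $t\in\mathbb R$ and $x+t\in(\alpha_j,\beta_j)$ with $i\ne j$. Then $$\sum\{b_\omega:\ \omega\in\mathcal P_{x,t},\ \operatorname{End}(x,t,\omega)=x+t\}=1,$$ and $$\sum\{b_\omega:\ \omega\in\mathcal P_{x,t},\ \operatorname{End}(x,t,\omega)=e\}=0\quad\text{for all } e\in\operatorname{Ends}(x,t),\ e\ne x+t.$$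
   Context: Setting: $n\ge 1$, $-\infty<\alpha_1<\beta_1<\alpha_2<\beta_2<\dots<\alpha_n<\beta_n<\infty$, $\Omega=\bigcup_{i=1}^n(\alpha_i,\beta_i)$, $l_i=\beta_i-\alpha_i$. Write $e_\lambda(x)=e^{2\pi \mathrm i\lambda x}$, $e_\lambda(\vec\alpha)=(e_\lambda(\alpha_1),\dots,e_\lambda(\alpha_n))$, and similarly $e_\lambda(\vec\beta)$. $\Omega$ is spectral if there is $\Lambda\subset\mathbb R$ (a spectrum) such that $\{e_\lambda:\lambda\in\Lambda\}$ is an orthogonal basis of $L^2(\Omega)$. Given a spectrum $\Lambda$, there is a unique unitary $n\times n$ matrix $B=(b_{i,j})$ with $Be_\lambda(\vec\alpha)=e_\lambda(\vec\beta)$ for all $\lambda\in\Lambda$; it is called the boundary matrix associated to $\Omega$ (and $\Lambda$). Admissible paths for $t>0$: for $x\in(\alpha_i,\beta_i)$, an admissible path for $x$ and $t$ is a finite sequence $\omega=i_1\dots i_m$ of indices in $\{1,\dots,n\}$ with $i_1=i$; if $t<\beta_i-x$ then $m=1$; if $t\ge\beta_i-x$ then $m\ge2$ and $$(\beta_i-x)+l_{i_2}+\dots+l_{i_{m-1}}\le t<(\beta_i-x)+l_{i_2}+\dots+l_{i_{m-1}}+l_{i_m}.$$ For $t\ge\beta_i-x$: $r(x,t,\omega)=t-((\beta_i-x)+l_{i_2}+\dots+l_{i_{m-1}})$, $b_\omega=b_{i_1,i_2}b_{i_2,i_3}\cdots b_{i_{m-1},i_m}$, $\operatorname{End}(x,t,\omega)=\alpha_{i_m}+r(x,t,\omega)$.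 Admissible paths for $t<0$: a finite sequence $\omega=i_1\dots i_m$ with $i_1=i$; if $t>\alpha_i-x$ then $m=1$; if $t\le\alpha_i-x$ then $m\ge2$ and $$(\alpha_i-x)-l_{i_2}-\dots-l_{i_{m-1}}\ge t>(\alpha_i-x)-l_{i_2}-\dots-l_{i_{m-1}}-l_{i_m}.$$ For $t\le\alpha_i-x$: $r(x,t,\omega)=(\alpha_i-x)-l_{i_2}-\dots-l_{i_{m-1}}-t$, $b_\omega=b^*_{i_1,i_2}b^*_{i_2,i_3}\cdots b^*_{i_{m-1},i_m}$ where $b^*_{i,j}=\overline{b_{j,i}}$ are the entries of $B^*$, and $\operatorname{End}(x,t,\omega)=\beta_{i_m}-r(x,t,\omega)$. In both cases $\mathcal P_{x,t}$ is the (finite) set of admissible paths for $x$ and $t$, and $\operatorname{Ends}(x,t)=\{\operatorname{End}(x,t,\omega):\omega\in\mathcal P_{x,t}\}$. *)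

theory Defs
  imports "HOL-Analysis.Analysis"
begin

text \<open>Orthogonal bases of the complex Hilbert space \<open>L\<^sup>2(\<Omega>)\<close>, with representatives instead of
  classes of functions equal almost everywhere.\<close>

definition L2 :: "real set \<Rightarrow> (real \<Rightarrow> complex) set" where
  "L2 \<Omega> = {f \<in> borel_measurable (lebesgue_on \<Omega>).
             integrable (lebesgue_on \<Omega>) (\<lambda>x. (cmod (f x))\<^sup>2)}"

definition L2_inner :: "real set \<Rightarrow> (real \<Rightarrow> complex) \<Rightarrow> (real \<Rightarrow> complex) \<Rightarrow> complex" where
  "L2_inner \<Omega> f g = (LINT x|lebesgue_on \<Omega>. f x * cnj (g x))"

definition L2_norm :: "real set \<Rightarrow> (real \<Rightarrow> complex) \<Rightarrow> real" where
  "L2_norm \<Omega> f = sqrt (LINT x|lebesgue_on \<Omega>. (cmod (f x))\<^sup>2)"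

text \<open>The last conjunct says that the linear span of \<open>S\<close> is dense in \<open>L\<^sup>2(\<Omega>)\<close>.\<close>

definition orthogonal_basis_L2 :: "real set \<Rightarrow> (real \<Rightarrow> complex) set \<Rightarrow> bool" where
  "orthogonal_basis_L2 \<Omega> S \<longleftrightarrow>
     S \<subseteq> L2 \<Omega> \<and>
     (\<forall>f\<in>S. L2_norm \<Omega> f \<noteq> 0) \<and>
     pairwise (\<lambda>f g. L2_inner \<Omega> f g = 0) S \<and>
     (\<forall>f\<in>L2 \<Omega>. \<forall>\<epsilon>>0. \<exists>F c. finite F \<and> F \<subseteq> S \<and>
        L2_norm \<Omega> (\<lambda>x. f x - (\<Sum>g\<in>F. c g * g x)) < \<epsilon>)"

definition e_fun :: "real \<Rightarrow> real \<Rightarrow> complex" where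
  "e_fun \<xi> x = exp (2 * of_real pi * \<i> * of_real \<xi> * of_real x)"

definition e_vec :: "real \<Rightarrow> real^'n \<Rightarrow> complex^'n" where
  "e_vec \<xi> a = (\<chi> i. e_fun \<xi> (a $ i))"

definition is_spectrum :: "real set \<Rightarrow> real set \<Rightarrow> bool" where
  "is_spectrum \<Omega> \<Lambda> \<longleftrightarrow> orthogonal_basis_L2 \<Omega> (e_fun ` \<Lambda>)"

definition spectral :: "real set \<Rightarrow> bool" where
  "spectral \<Omega> \<longleftrightarrow> (\<exists>\<Lambda>. is_spectrum \<Omega> \<Lambda>)"

text \<open>The index set \<open>{1,\<dots>,n}\<close> is an arbitrary finite linearly ordered type \<open>'n\<close>, so that
  \<open>n = CARD('n) \<ge> 1\<close>.\<close>

definition Omega :: "real^'n \<Rightarrow> real^'n \<Rightarrow> real set" where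
  "Omega \<alpha> \<beta> = (\<Union>i. {\<alpha> $ i <..< \<beta> $ i})"

definition ordered_endpoints :: "real^('n::{finite,linorder}) \<Rightarrow> real^('n::{finite,linorder}) \<Rightarrow> bool" where
  "ordered_endpoints \<alpha> \<beta> \<longleftrightarrow>
     (\<forall>i. \<alpha> $ i < \<beta> $ i) \<and> (\<forall>i j. i < j \<longrightarrow> \<beta> $ i < \<alpha> $ j)"

definition len :: "real^'n \<Rightarrow> real^'n \<Rightarrow> 'n \<Rightarrow> real" where
  "len \<alpha> \<beta> k = \<beta> $ k - \<alpha> $ k"

definition mat_adj :: "complex^'n^'m \<Rightarrow> complex^'m^'n" where
  "mat_adj A = (\<chi> i j. cnj (A $ j $ i))"

definition unitary_matrix :: "complex^'n^'n \<Rightarrow> bool" where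
  "unitary_matrix A \<longleftrightarrow> A ** mat_adj A = mat 1 \<and> mat_adj A ** A = mat 1"

text \<open>A spectrum \<open>\<Lambda>\<close> determines its boundary matrix uniquely, so the following predicate names
  one matrix.\<close>

definition boundary_matrix :: "real^'n \<Rightarrow> real^'n \<Rightarrow> real set \<Rightarrow> complex^'n^'n \<Rightarrow> bool" where
  "boundary_matrix \<alpha> \<beta> \<Lambda> B \<longleftrightarrow>
     unitary_matrix B \<and> (\<forall>\<xi>\<in>\<Lambda>. B *v e_vec \<xi> \<alpha> = e_vec \<xi> \<beta>)"

text \<open>Paths \<open>\<omega> = i\<^sub>1\<dots>i\<^sub>m\<close> are lists; \<open>butlast (tl \<omega>)\<close> is \<open>i\<^sub>2\<dots>i\<^bsub>m-1\<^esub>\<close>.\<close>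

definition inner_len :: "real^'n \<Rightarrow> real^'n \<Rightarrow> 'n list \<Rightarrow> real" where
  "inner_len \<alpha> \<beta> \<omega> = (\<Sum>k\<leftarrow>butlast (tl \<omega>). len \<alpha> \<beta> k)"

text \<open>For \<open>t = 0\<close> the second branch below gives the one-letter path, as the first one would.\<close>

definition admissible :: "real^'n \<Rightarrow> real^'n \<Rightarrow> real \<Rightarrow> real \<Rightarrow> 'n list \<Rightarrow> bool" where
  "admissible \<alpha> \<beta> x t \<omega> \<longleftrightarrow>
     \<omega> \<noteq> [] \<and> x \<in> {\<alpha> $ hd \<omega> <..< \<beta> $ hd \<omega>} \<and>
     (if t > 0 then
        (if t < \<beta> $ hd \<omega> - x then length \<omega> = 1
         else length \<omega> \<ge> 2 \<and>
              (\<beta> $ hd \<omega> - x) + inner_len \<alpha> \<beta> \<omega> \<le> t \<and>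
              t < (\<beta> $ hd \<omega> - x) + inner_len \<alpha> \<beta> \<omega> + len \<alpha> \<beta> (last \<omega>))
      else
        (if t > \<alpha> $ hd \<omega> - x then length \<omega> = 1
         else length \<omega> \<ge> 2 \<and>
              (\<alpha> $ hd \<omega> - x) - inner_len \<alpha> \<beta> \<omega> \<ge> t \<and>
              t > (\<alpha> $ hd \<omega> - x) - inner_len \<alpha> \<beta> \<omega> - len \<alpha> \<beta> (last \<omega>)))"

definition paths :: "real^'n \<Rightarrow> real^'n \<Rightarrow> real \<Rightarrow> real \<Rightarrow> 'n list set" where
  "paths \<alpha> \<beta> x t = {\<omega>. admissible \<alpha> \<beta> x t \<omega>}"

definition remainder :: "real^'n \<Rightarrow> real^'n \<Rightarrow> real \<Rightarrow> real \<Rightarrow> 'n list \<Rightarrow> real" where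
  "remainder \<alpha> \<beta> x t \<omega> =
     (if t > 0 then t - ((\<beta> $ hd \<omega> - x) + inner_len \<alpha> \<beta> \<omega>)
      else (\<alpha> $ hd \<omega> - x) - inner_len \<alpha> \<beta> \<omega> - t)"

text \<open>For one-letter paths, which never leave their interval, we put \<open>End = x + t\<close> and
  (as the empty product) \<open>b\<^sub>\<omega> = 1\<close>.\<close>

definition path_end :: "real^'n \<Rightarrow> real^'n \<Rightarrow> real \<Rightarrow> real \<Rightarrow> 'n list \<Rightarrow> real" where
  "path_end \<alpha> \<beta> x t \<omega> =
     (if length \<omega> = 1 then x + t
      else if t > 0 then \<alpha> $ last \<omega> + remainder \<alpha> \<beta> x t \<omega>
      else \<beta> $ last \<omega> - remainder \<alpha> \<beta> x t \<omega>)"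

definition Ends :: "real^'n \<Rightarrow> real^'n \<Rightarrow> real \<Rightarrow> real \<Rightarrow> real set" where
  "Ends \<alpha> \<beta> x t = path_end \<alpha> \<beta> x t ` paths \<alpha> \<beta> x t"

definition path_prod :: "complex^'n^'n \<Rightarrow> 'n list \<Rightarrow> complex" where
  "path_prod M \<omega> = (\<Prod>(i, j)\<leftarrow>zip \<omega> (tl \<omega>). M $ i $ j)"

definition path_weight :: "complex^'n^'n \<Rightarrow> real \<Rightarrow> 'n list \<Rightarrow> complex" where
  "path_weight B t \<omega> = path_prod (if t > 0 then B else mat_adj B) \<omega>"

end

theory Submission
  imports Defs
begin

text \<open>For a frequency \<open>\<xi>\<close> of the spectrum, the boundary relation rewrites \<open>e_fun \<xi> (\<beta> $ i)\<close> as a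
  combination of the values at the left endpoints. Iterating this whenever the translate of \<open>x\<close>
  leaves an interval expresses \<open>e_fun \<xi> (x + t)\<close> as the sum, over the admissible paths, of the path
  weights times \<open>e_fun \<xi>\<close> at the path ends. Completeness of the exponentials makes the evaluations
  at finitely many points of \<open>\<Omega>\<close> linearly independent on the spectrum, and multiplying by
  \<open>e_fun \<xi> s\<close> with \<open>s\<close> small moves path ends off the endpoints into \<open>\<Omega>\<close>. Comparing coefficients
  gives (ii). In particular some path jumps from \<open>x\<close> to \<open>x + t\<close>, and its inner intervals fill the
  gap, which is (i).\<close>

section \<open>Exponentials: multiplicativity and integrals over intervals\<close>

lemma e_fun_add: "e_fun \<xi> (x + y) = e_fun \<xi> x * e_fun \<xi> y"
  by (simp add: e_fun_def ring_distribs exp_add)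

lemma e_fun_mult_cnj: "e_fun \<xi> x * cnj (e_fun \<eta> x) = e_fun (\<xi> - \<eta>) x"
  by (simp add: e_fun_def exp_cnj flip: exp_add) (simp add: algebra_simps)

lemma continuous_on_e_fun: "continuous_on S (e_fun \<xi>)"
  unfolding e_fun_def by (intro continuous_intros)

lemma has_integral_e_fun:
  assumes "\<xi> \<noteq> 0" "a \<le> b"
  shows "(e_fun \<xi> has_integral (e_fun \<xi> b - e_fun \<xi> a) / (2 * of_real pi * \<i> * of_real \<xi>)) {a<..<b}"
proof -
  let ?c = "2 * of_real pi * \<i> * of_real \<xi> :: complex"
  have "?c \<noteq> 0"
    using assms by simp
  have e: "e_fun \<xi> = (\<lambda>x. exp (x *\<^sub>R ?c))"
    by (auto simp: e_fun_def scaleR_conv_of_real mult_ac)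
  have "((\<lambda>x. e_fun \<xi> x / ?c) has_vector_derivative e_fun \<xi> x * ?c / ?c) (at x within {a..b})" for x
    unfolding e by (intro has_vector_derivative_divide exp_scaleR_has_vector_derivative_right)
  then have "((\<lambda>x. e_fun \<xi> x / ?c) has_vector_derivative e_fun \<xi> x) (at x within {a..b})" for x
    using \<open>?c \<noteq> 0\<close> by (metis nonzero_mult_div_cancel_right)
  then have "(e_fun \<xi> has_integral (e_fun \<xi> b / ?c - e_fun \<xi> a / ?c)) {a..b}"
    by (intro fundamental_theorem_of_calculus assms)
  then show ?thesis
    by (simp add: has_integral_Icc_iff_Ioo diff_divide_distrib)
qed

subsection \<open>Orthogonality and completeness\<close>

lemma L2_integrable_mult_cnj:
  assumes "f \<in> L2 S" "g \<in> L2 S"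
  shows "integrable (lebesgue_on S) (\<lambda>x. f x * cnj (g x))"
proof (rule Bochner_Integration.integrable_bound)
  show "integrable (lebesgue_on S) (\<lambda>x. (cmod (f x))\<^sup>2 + (cmod (g x))\<^sup>2)"
    using assms by (auto simp: L2_def)
  have [measurable]: "f \<in> borel_measurable (lebesgue_on S)" "g \<in> borel_measurable (lebesgue_on S)"
    using assms by (auto simp: L2_def)
  have "(\<lambda>x. cnj (g x)) \<in> borel_measurable (lebesgue_on S)"
    by (rule measurable_compose[of g _ borel])
       (simp_all add: borel_measurable_continuous_onI continuous_on_cnj continuous_on_id)
  then show "(\<lambda>x. f x * cnj (g x)) \<in> borel_measurable (lebesgue_on S)"
    by measurable
  have "a * b \<le> a\<^sup>2 + b\<^sup>2" if "0 \<le> a" "0 \<le> b" for a b :: real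
    using sum_squares_bound[of a b] mult_nonneg_nonneg[OF that] by linarith
  then show "AE x in lebesgue_on S. norm (f x * cnj (g x)) \<le> norm ((cmod (f x))\<^sup>2 + (cmod (g x))\<^sup>2)"
    by (auto simp: norm_mult)
qed

lemma L2_scale:
  assumes "f \<in> L2 S"
  shows "(\<lambda>x. c * f x) \<in> L2 S"
  using assms by (auto simp: L2_def norm_mult power_mult_distrib)

lemma L2_add:
  assumes "f \<in> L2 S" "g \<in> L2 S"
  shows "(\<lambda>x. f x + g x) \<in> L2 S"
proof -
  have [measurable]: "f \<in> borel_measurable (lebesgue_on S)" "g \<in> borel_measurable (lebesgue_on S)"
    using assms by (auto simp: L2_def)
  have "integrable (lebesgue_on S) (\<lambda>x. (cmod (f x + g x))\<^sup>2)"
  proof (rule Bochner_Integration.integrable_bound)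
    show "integrable (lebesgue_on S) (\<lambda>x. 2 * (cmod (f x))\<^sup>2 + 2 * (cmod (g x))\<^sup>2)"
      using assms by (auto simp: L2_def)
    have "(cmod (z + w))\<^sup>2 \<le> 2 * (cmod z)\<^sup>2 + 2 * (cmod w)\<^sup>2" for z w
    proof -
      have "(cmod (z + w))\<^sup>2 \<le> (cmod z + cmod w)\<^sup>2"
        by (intro power_mono norm_triangle_ineq) auto
      then show ?thesis
        using sum_squares_bound[of "cmod z" "cmod w"] by (simp add: power2_sum)
    qed
    then show "AE x in lebesgue_on S.
        norm ((cmod (f x + g x))\<^sup>2) \<le> norm (2 * (cmod (f x))\<^sup>2 + 2 * (cmod (g x))\<^sup>2)"
      by auto
  qed measurable
  then show ?thesis
    by (simp add: L2_def)
qed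

lemma L2_sum:
  assumes "\<And>i. i \<in> I \<Longrightarrow> f i \<in> L2 S"
  shows "(\<lambda>x. \<Sum>i\<in>I. f i x) \<in> L2 S"
  using assms
proof (induction I rule: infinite_finite_induct)
  case (insert i I)
  then show ?case
    using L2_add[of "f i" S "\<lambda>x. \<Sum>i\<in>I. f i x"] by auto
qed (auto simp: L2_def)

lemma bounded_in_L2:
  assumes "S \<in> lmeasurable" "f \<in> borel_measurable (lebesgue_on S)" "\<And>x. cmod (f x) \<le> C"
  shows "f \<in> L2 S"
proof -
  have "integrable (lebesgue_on S) (\<lambda>x. (cmod (f x))\<^sup>2)"
    using assms
    by (intro finite_measure.integrable_const_bound[of _ _ "C\<^sup>2"] finite_measure_lebesgue_on)
       (auto intro!: power_mono)
  with assms(2) show ?thesis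
    by (simp add: L2_def)
qed

text \<open>Approximate \<open>g\<close> by a combination \<open>p\<close> of elements of
  \<open>F\<close>. Since \<open>p\<close> is orthogonal to \<open>g\<close>, Pythagoras bounds the
  norm of \<open>g\<close> by that of \<open>g - p\<close>, which is as small as desired.\<close>

lemma orthogonal_basis_L2_complete:
  assumes basis: "orthogonal_basis_L2 S F" and g: "g \<in> L2 S"
    and orth: "\<And>f. f \<in> F \<Longrightarrow> L2_inner S f g = 0"
  shows "L2_norm S g = 0"
proof -
  have "L2_norm S g < \<epsilon>" if "\<epsilon> > 0" for \<epsilon>
  proof -
    obtain G c where G: "finite G" "G \<subseteq> F"
      and approx: "L2_norm S (\<lambda>x. g x - (\<Sum>f\<in>G. c f * f x)) < \<epsilon>"
      using basis g \<open>\<epsilon> > 0\<close> unfolding orthogonal_basis_L2_def by blast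
    define p where "p x = (\<Sum>f\<in>G. c f * f x)" for x
    have FL2: "f \<in> L2 S" if "f \<in> F" for f
      using basis that by (auto simp: orthogonal_basis_L2_def)
    have p: "p \<in> L2 S"
      unfolding p_def using G FL2 by (intro L2_sum L2_scale) auto
    have "(LINT x|lebesgue_on S. p x * cnj (g x)) = (\<Sum>f\<in>G. c f * L2_inner S f g)"
      unfolding p_def L2_inner_def sum_distrib_right mult.assoc
      using G by (subst Bochner_Integration.integral_sum) (auto intro!: L2_integrable_mult_cnj FL2 g)
    also have "\<dots> = 0"
      using orth G by (intro sum.neutral) auto
    finally have pg: "(LINT x|lebesgue_on S. p x * cnj (g x)) = 0" .
    have "(LINT x|lebesgue_on S. (cmod (g x - p x))\<^sup>2) =
        (LINT x|lebesgue_on S. (cmod (g x))\<^sup>2 + (cmod (p x))\<^sup>2 - 2 * Re (p x * cnj (g x)))"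
      by (intro Bochner_Integration.integral_cong refl, unfold cmod_power2)
         (simp add: power2_eq_square algebra_simps)
    also have "\<dots> = (LINT x|lebesgue_on S. (cmod (g x))\<^sup>2) + (LINT x|lebesgue_on S. (cmod (p x))\<^sup>2)
        - 2 * Re (LINT x|lebesgue_on S. p x * cnj (g x))"
      using p g L2_integrable_mult_cnj[OF p g] by (simp add: L2_def del: complex_mult_cnj times_complex.sel)
    finally have "(LINT x|lebesgue_on S. (cmod (g x))\<^sup>2) \<le> (LINT x|lebesgue_on S. (cmod (g x - p x))\<^sup>2)"
      by (simp add: pg)
    then have "L2_norm S g \<le> L2_norm S (\<lambda>x. g x - p x)"
      by (simp add: L2_norm_def)
    with approx show ?thesis
      by (simp add: p_def)
  qed
  moreover have "L2_norm S g \<ge> 0"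
    by (simp add: L2_norm_def)
  ultimately show ?thesis
    by (metis less_irrefl order_le_less)
qed

text \<open>Multiplying the relation by \<open>e_fun \<xi> s\<close> and integrating over small \<open>s\<close> turns the point
  evaluations into inner products with indicators of short intervals.\<close>

lemma e_fun_points_independent:
  assumes S: "open S" "S \<in> lmeasurable" and spec: "is_spectrum S \<Lambda>"
    and Y: "finite Y" "Y \<subseteq> S"
    and rel: "\<And>\<xi>. \<xi> \<in> \<Lambda> \<Longrightarrow> (\<Sum>y\<in>Y. d y * e_fun \<xi> y) = 0"
    and z: "z \<in> Y"
  shows "d z = 0"
proof -
  \<comment> \<open>The radius must keep all balls inside \<open>S\<close> and separate the ball at
    \<open>z\<close> from the others. Balls at points other than \<open>z\<close> may overlap each
    other.\<close>
  have "\<forall>\<^sub>F \<epsilon> in at_right 0. cball y \<epsilon> \<subseteq> S \<and> (y \<noteq> z \<longrightarrow> 2 * \<epsilon> < dist y z)" if "y \<in> Y" for y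
  proof -
    have "y \<in> S"
      using Y that by auto
    then obtain r where r: "r > 0" "cball y r \<subseteq> S"
      using S(1) by (auto simp: open_contains_cball)
    define \<delta> where "\<delta> = (if y = z then r else min r (dist y z / 2))"
    have "\<delta> > 0"
      using \<open>r > 0\<close> by (simp add: \<delta>_def)
    moreover have "cball y \<epsilon> \<subseteq> S \<and> (y \<noteq> z \<longrightarrow> 2 * \<epsilon> < dist y z)" if "\<epsilon> < \<delta>" for \<epsilon>
    proof -
      have "\<epsilon> \<le> r" "y \<noteq> z \<longrightarrow> 2 * \<epsilon> < dist y z"
        using that by (auto simp: \<delta>_def split: if_splits)
      then show ?thesis
        using order_trans[OF subset_cball r(2)] by simp
    qed
    ultimately show ?thesis
      unfolding eventually_at_right_field by (intro exI[of _ \<delta>]) blast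
  qed
  then have "\<forall>\<^sub>F \<epsilon> in at_right (0::real). \<forall>y\<in>Y. cball y \<epsilon> \<subseteq> S \<and> (y \<noteq> z \<longrightarrow> 2 * \<epsilon> < dist y z)"
    using Y by (intro eventually_ball_finite ballI)
  moreover have "\<forall>\<^sub>F \<epsilon> in at_right (0::real). \<epsilon> > 0"
    by (simp add: eventually_at_right_less)
  ultimately have "\<forall>\<^sub>F \<epsilon> in at_right (0::real). \<epsilon> > 0 \<and> (\<forall>y\<in>Y. cball y \<epsilon> \<subseteq> S \<and> (y \<noteq> z \<longrightarrow> 2 * \<epsilon> < dist y z))"
    by eventually_elim auto
  from eventually_happens'[OF trivial_limit_at_right_real this]
  obtain \<epsilon> :: real where \<epsilon>: "\<epsilon> > 0" "\<And>y. y \<in> Y \<Longrightarrow> cball y \<epsilon> \<subseteq> S"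
      "\<And>y. y \<in> Y \<Longrightarrow> y \<noteq> z \<Longrightarrow> 2 * \<epsilon> < dist y z"
    by blast
  have Smeas: "S \<in> sets lebesgue"
    using S by auto
  have ind_meas: "indicator (cball y \<epsilon>) \<in> borel_measurable (lebesgue_on S)" for y
    using Smeas by (intro measurable_restrict_space1 borel_measurable_indicator) auto
  have ind: "(\<lambda>x. indicator (cball y \<epsilon>) x :: complex) \<in> L2 S" for y
    using S by (intro bounded_in_L2[where C = 1] ind_meas) (auto simp: indicator_def)
  \<comment> \<open>\<open>L2_inner\<close> is conjugate linear in its second argument, so the
    coefficients are conjugated here in order to reappear as \<open>d y\<close>.\<close>
  define g where "g x = (\<Sum>y\<in>Y. cnj (d y) * indicator (cball y \<epsilon>) x)" for x
  have g: "g \<in> L2 S"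
    unfolding g_def by (intro L2_sum L2_scale ind)
  have "L2_inner S (e_fun \<xi>) g = 0" if "\<xi> \<in> \<Lambda>" for \<xi>
  proof -
    have eL2: "e_fun \<xi> \<in> L2 S"
      using spec that by (auto simp: is_spectrum_def orthogonal_basis_L2_def)
    have int: "integrable (lebesgue_on S) (\<lambda>x. e_fun \<xi> x * cnj (indicator (cball y \<epsilon>) x))" for y
      by (intro L2_integrable_mult_cnj eL2 ind)
    have "L2_inner S (e_fun \<xi>) g =
        (LINT x|lebesgue_on S. (\<Sum>y\<in>Y. d y * (e_fun \<xi> x * cnj (indicator (cball y \<epsilon>) x))))"
      unfolding L2_inner_def g_def by (simp add: sum_distrib_left mult_ac)
    also have "\<dots> = (\<Sum>y\<in>Y. d y * (LINT x|lebesgue_on S. e_fun \<xi> x * cnj (indicator (cball y \<epsilon>) x)))"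
      by (subst Bochner_Integration.integral_sum) (auto intro!: int)
    \<comment> \<open>All balls are translates of the one at 0, so the integral over the ball at
      \<open>y\<close> is \<open>e_fun \<xi> y\<close> times a factor independent of
      \<open>y\<close>.\<close>
    also have "\<dots> = (\<Sum>y\<in>Y. d y * (e_fun \<xi> y * integral {-\<epsilon>..\<epsilon>} (e_fun \<xi>)))"
    proof (intro sum.cong refl arg_cong2[where f = "(*)"])
      fix y assume "y \<in> Y"
      have "(LINT x|lebesgue_on S. e_fun \<xi> x * cnj (indicator (cball y \<epsilon>) x)) =
          integral S (\<lambda>x. e_fun \<xi> x * cnj (indicator (cball y \<epsilon>) x))"
        by (intro lebesgue_integral_eq_integral int Smeas)
      also have "\<dots> = integral S (\<lambda>x. if x \<in> cball y \<epsilon> then e_fun \<xi> x else 0)"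
        by (intro arg_cong[where f = "integral S"]) (auto simp: indicator_def)
      also have "\<dots> = integral (cball y \<epsilon>) (e_fun \<xi>)"
        using \<epsilon>(2)[OF \<open>y \<in> Y\<close>] by (simp only: integral_restrict_Int Int_absorb2)
      also have "\<dots> = integral {-\<epsilon> + y..\<epsilon> + y} (e_fun \<xi>)"
        by (simp add: cball_eq_atLeastAtMost add.commute)
      also have "\<dots> = integral {-\<epsilon>..\<epsilon>} (e_fun \<xi> \<circ> (\<lambda>x. x + y))"
        by (intro integral_shift[symmetric] continuous_on_e_fun)
      also have "e_fun \<xi> \<circ> (\<lambda>x. x + y) = (\<lambda>x. e_fun \<xi> y * e_fun \<xi> x)"
        by (auto simp: e_fun_add)
      finally show "(LINT x|lebesgue_on S. e_fun \<xi> x * cnj (indicator (cball y \<epsilon>) x)) =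
          e_fun \<xi> y * integral {-\<epsilon>..\<epsilon>} (e_fun \<xi>)"
        by simp
    qed
    also have "\<dots> = (\<Sum>y\<in>Y. d y * e_fun \<xi> y) * integral {-\<epsilon>..\<epsilon>} (e_fun \<xi>)"
      by (simp add: sum_distrib_right mult.assoc)
    finally show ?thesis
      using rel[OF that] by simp
  qed
  then have "L2_norm S g = 0"
    using spec g by (intro orthogonal_basis_L2_complete[of S "e_fun ` \<Lambda>"]) (auto simp: is_spectrum_def)
  then have g0: "(LINT x|lebesgue_on S. (cmod (g x))\<^sup>2) = 0"
    by (simp add: L2_norm_def)
  \<comment> \<open>On the ball at \<open>z\<close>, of length \<open>2 * \<epsilon>\<close>, the
    function \<open>g\<close> is the constant \<open>cnj (d z)\<close>; this bounds the squared norm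
    of \<open>g\<close> from below.\<close>
  have "(cmod (d z))\<^sup>2 * (2 * \<epsilon>) = (LINT x|lebesgue_on S. (cmod (d z))\<^sup>2 * indicator (cball z \<epsilon>) x)"
  proof -
    have "measure (lebesgue_on S) (cball z \<epsilon>) = measure lebesgue (cball z \<epsilon>)"
      using \<epsilon> z Smeas by (intro measure_restrict_space) auto
    also have "\<dots> = 2 * \<epsilon>"
      using \<epsilon> by (simp add: cball_eq_atLeastAtMost)
    finally show ?thesis
      using \<epsilon>(2)[OF z] by (simp add: Int_absorb2)
  qed
  also have "\<dots> \<le> (LINT x|lebesgue_on S. (cmod (g x))\<^sup>2)"
  proof (rule integral_mono)
    have "integrable (lebesgue_on S) (indicator (cball z \<epsilon>) :: real \<Rightarrow> real)"
      using S by (intro finite_measure.integrable_const_bound[of _ _ 1] finite_measure_lebesgue_on ind_meas)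
        (auto simp: indicator_def)
    then show "integrable (lebesgue_on S) (\<lambda>x. (cmod (d z))\<^sup>2 * indicator (cball z \<epsilon>) x)"
      by simp
    show "integrable (lebesgue_on S) (\<lambda>x. (cmod (g x))\<^sup>2)"
      using g by (simp add: L2_def)
    fix x
    show "(cmod (d z))\<^sup>2 * indicator (cball z \<epsilon>) x \<le> (cmod (g x))\<^sup>2"
    proof (cases "x \<in> cball z \<epsilon>")
      case True
      have "x \<notin> cball y \<epsilon>" if "y \<in> Y - {z}" for y
        using \<epsilon>(3)[of y] that True dist_triangle2[of y z x] by (auto simp: dist_commute)
      then have "g x = cnj (d z)"
        using True Y z by (auto simp: g_def sum.remove intro!: sum.neutral)
      then show ?thesis
        using True by simp
    qed simp
  qed
  finally have "(cmod (d z))\<^sup>2 * (2 * \<epsilon>) \<le> 0"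
    by (simp add: g0)
  then show ?thesis
    using \<epsilon> by (auto simp: mult_le_0_iff)
qed


text \<open>Collecting terms with equal \<open>h p\<close> gives a relation between point
  evaluations, to which independence applies once the points lie in \<open>S\<close>. The filter
  \<open>F\<close> provides a single shift \<open>s\<close> that moves all of them into
  \<open>S\<close>; it is a parameter because path ends need a shift to the right or to the left,
  depending on the direction of time.\<close>

lemma e_fun_relation_coefficients:
  fixes F :: "real filter"
  assumes S: "open S" "S \<in> lmeasurable" and spec: "is_spectrum S \<Lambda>"
    and P: "finite P"
    and rel: "\<And>\<xi>. \<xi> \<in> \<Lambda> \<Longrightarrow> e_fun \<xi> y = (\<Sum>p\<in>P. w p * e_fun \<xi> (h p))"
    and F: "F \<noteq> bot" and shift: "\<And>z. z \<in> insert y (h ` P) \<Longrightarrow> \<forall>\<^sub>F s in F. z + s \<in> S"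
  shows "(\<Sum>p\<in>{p \<in> P. h p = e}. w p) = (if e = y then 1 else 0)"
proof (cases "e \<in> insert y (h ` P)")
  case True
  define Y where "Y = insert y (h ` P)"
  \<comment> \<open>The net coefficient at \<open>z\<close> once \<open>e_fun \<xi> y\<close> has
    been moved to the other side.\<close>
  define d where "d z = (\<Sum>p\<in>{p \<in> P. h p = z}. w p) - (if z = y then 1 else 0)" for z
  have Y: "finite Y"
    using P by (simp add: Y_def)
  have "\<forall>\<^sub>F s in F. \<forall>z\<in>Y. z + s \<in> S"
    using Y shift by (intro eventually_ball_finite) (auto simp: Y_def)
  from eventually_happens'[OF F this] obtain s where s: "\<And>z. z \<in> Y \<Longrightarrow> z + s \<in> S"
    by blast
  have "(\<Sum>z\<in>(\<lambda>z. z + s) ` Y. d (z - s) * e_fun \<xi> z) = 0" if "\<xi> \<in> \<Lambda>" for \<xi>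
  proof -
    have "(\<Sum>z\<in>Y. (\<Sum>p\<in>{p \<in> P. h p = z}. w p) * e_fun \<xi> z) = (\<Sum>z\<in>Y. \<Sum>p\<in>{p \<in> P. h p = z}. w p * e_fun \<xi> (h p))"
      by (auto simp: sum_distrib_right intro!: sum.cong)
    also have "\<dots> = (\<Sum>p\<in>P. w p * e_fun \<xi> (h p))"
      using P Y by (intro sum.group) (auto simp: Y_def)
    finally have "(\<Sum>z\<in>Y. (\<Sum>p\<in>{p \<in> P. h p = z}. w p) * e_fun \<xi> z) = e_fun \<xi> y"
      using rel[OF that] by simp
    moreover have "(\<Sum>z\<in>Y. (if z = y then 1 else 0) * e_fun \<xi> z) = (\<Sum>z\<in>Y. if z = y then e_fun \<xi> z else 0)"
      by (intro sum.cong) auto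
    moreover have "\<dots> = e_fun \<xi> y"
      using Y by (simp add: Y_def sum.delta)
    ultimately have "(\<Sum>z\<in>Y. d z * e_fun \<xi> z) = 0"
      unfolding d_def left_diff_distrib sum_subtractf by simp
    moreover have "(\<Sum>z\<in>(\<lambda>z. z + s) ` Y. d (z - s) * e_fun \<xi> z) = (\<Sum>z\<in>Y. d z * e_fun \<xi> z) * e_fun \<xi> s"
      by (subst sum.reindex) (auto simp: e_fun_add sum_distrib_right mult.assoc)
    ultimately show ?thesis
      by simp
  qed
  then have "d (e + s - s) = 0"
    using True Y s
    by (intro e_fun_points_independent[OF S spec, of "(\<lambda>z. z + s) ` Y" "\<lambda>z. d (z - s)"])
       (auto simp: Y_def)
  then show ?thesis
    by (simp add: d_def)
next
  case False
  then have "{p \<in> P. h p = e} = {}"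
    by auto
  with False show ?thesis
    by (simp only: sum.empty) auto
qed

subsection \<open>Existence of a boundary matrix\<close>

lemma Omega_open: "open (Omega \<alpha> \<beta>)"
  unfolding Omega_def by auto

lemma Omega_lmeasurable: "Omega \<alpha> \<beta> \<in> lmeasurable"
  unfolding Omega_def by (intro fmeasurable.finite_UN) auto

text \<open>The intervals are closed on the left so that path ends in positive time, which may be
  left endpoints, are covered as well.\<close>

lemma interval_index_unique:
  assumes "ordered_endpoints \<alpha> \<beta>" "y \<in> {\<alpha> $ i..<\<beta> $ i}" "y \<in> {\<alpha> $ j..<\<beta> $ j}"
  shows "i = j"
proof (rule ccontr)
  assume "i \<noteq> j"
  then have "\<beta> $ i < \<alpha> $ j \<or> \<beta> $ j < \<alpha> $ i"
    using assms(1) by (metis ordered_endpoints_def neqE)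
  with assms show False
    by auto
qed

text \<open>For different exponentials, the inner product over \<open>Omega \<alpha> \<beta>\<close>
  is the difference of the two sums divided by a nonzero constant, and it vanishes by
  orthogonality.\<close>

lemma spectrum_gram_eq:
  assumes ord: "ordered_endpoints \<alpha> \<beta>" and spec: "is_spectrum (Omega \<alpha> \<beta>) \<Lambda>"
    and "\<xi> \<in> \<Lambda>" "\<eta> \<in> \<Lambda>"
  shows "(\<Sum>i\<in>UNIV. e_fun (\<xi> - \<eta>) (\<beta> $ i)) = (\<Sum>i\<in>UNIV. e_fun (\<xi> - \<eta>) (\<alpha> $ i))"
proof (cases "e_fun \<xi> = e_fun \<eta>")
  case True
  then have "e_fun (\<xi> - \<eta>) x = 1" for x
    by (metis e_fun_mult_cnj diff_self e_fun_def mult_zero_left mult_zero_right of_real_0 exp_zero)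
  then show ?thesis
    by simp
next
  case False
  define c where "c = 2 * of_real pi * \<i> * complex_of_real (\<xi> - \<eta>)"
  have "\<xi> \<noteq> \<eta>"
    using False by auto
  then have "c \<noteq> 0"
    by (simp add: c_def)
  have L2: "e_fun \<xi> \<in> L2 (Omega \<alpha> \<beta>)" "e_fun \<eta> \<in> L2 (Omega \<alpha> \<beta>)"
    using spec assms(3,4) by (auto simp: is_spectrum_def orthogonal_basis_L2_def)
  have "L2_inner (Omega \<alpha> \<beta>) (e_fun \<xi>) (e_fun \<eta>) = 0"
    using spec assms(3,4) False
    by (auto simp: is_spectrum_def orthogonal_basis_L2_def pairwise_def)
  then have "0 = (LINT x|lebesgue_on (Omega \<alpha> \<beta>). e_fun (\<xi> - \<eta>) x)"
    by (simp add: L2_inner_def e_fun_mult_cnj)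
  also have "\<dots> = integral (Omega \<alpha> \<beta>) (e_fun (\<xi> - \<eta>))"
    using L2_integrable_mult_cnj[OF L2] Omega_lmeasurable
    by (intro lebesgue_integral_eq_integral) (auto simp: e_fun_mult_cnj)
  also have "(e_fun (\<xi> - \<eta>) has_integral
      (\<Sum>i\<in>UNIV. (e_fun (\<xi> - \<eta>) (\<beta> $ i) - e_fun (\<xi> - \<eta>) (\<alpha> $ i)) / c)) (Omega \<alpha> \<beta>)"
    unfolding Omega_def c_def
  proof (intro has_integral_UN has_integral_e_fun)
    show "pairwise (\<lambda>i j. negligible ({\<alpha> $ i<..<\<beta> $ i} \<inter> {\<alpha> $ j<..<\<beta> $ j})) UNIV"
    proof (intro pairwiseI)
      fix i j :: 'a
      assume "i \<noteq> j"
      then have "{\<alpha> $ i<..<\<beta> $ i} \<inter> {\<alpha> $ j<..<\<beta> $ j} = {}"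
        using interval_index_unique[OF ord, of _ i j] by fastforce
      then show "negligible ({\<alpha> $ i<..<\<beta> $ i} \<inter> {\<alpha> $ j<..<\<beta> $ j})"
        by simp
    qed
  qed (use ord \<open>\<xi> \<noteq> \<eta>\<close> in \<open>auto simp: ordered_endpoints_def less_imp_le\<close>)
  then have "integral (Omega \<alpha> \<beta>) (e_fun (\<xi> - \<eta>)) =
      (\<Sum>i\<in>UNIV. (e_fun (\<xi> - \<eta>) (\<beta> $ i) - e_fun (\<xi> - \<eta>) (\<alpha> $ i)) / c)"
    by (rule integral_unique)
  finally show ?thesis
    using \<open>c \<noteq> 0\<close> by (simp add: sum_subtractf flip: sum_divide_distrib)
qed

text \<open>Orthogonality makes the Gram matrices of the vectors \<open>e_vec \<xi> \<alpha>\<close> and \<open>e_vec \<xi> \<beta>\<close> equal,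
  so every linear relation among the former holds among the latter.\<close>

lemma boundary_relation:
  assumes ord: "ordered_endpoints \<alpha> \<beta>" and spec: "is_spectrum (Omega \<alpha> \<beta>) \<Lambda>"
    and I: "p ` I \<subseteq> \<Lambda>" and rel: "(\<Sum>k\<in>I. c k *s e_vec (p k) \<alpha>) = 0"
  shows "(\<Sum>k\<in>I. c k *s e_vec (p k) \<beta>) = 0"
proof -
  \<comment> \<open>The squared norm of the combination is a quadratic form in \<open>c\<close>
    whose coefficients are the Gram entries; by \<open>spectrum_gram_eq\<close> its value is the
    same at \<open>\<alpha>\<close> and \<open>\<beta>\<close>.\<close>
  have gram: "(\<Sum>i\<in>UNIV. (\<Sum>k\<in>I. c k *s e_vec (p k) a) $ i * cnj ((\<Sum>k\<in>I. c k *s e_vec (p k) a) $ i)) =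
      (\<Sum>k\<in>I. \<Sum>l\<in>I. c k * cnj (c l) * (\<Sum>i\<in>UNIV. e_fun (p k - p l) (a $ i)))" (is "?L a = _")
    for a
  proof -
    have "?L a = (\<Sum>i\<in>UNIV. \<Sum>k\<in>I. \<Sum>l\<in>I. c k * cnj (c l) * e_fun (p k - p l) (a $ i))"
      by (simp add: e_vec_def sum_product flip: e_fun_mult_cnj) (simp add: mult_ac)
    also have "\<dots> = (\<Sum>k\<in>I. \<Sum>i\<in>UNIV. \<Sum>l\<in>I. c k * cnj (c l) * e_fun (p k - p l) (a $ i))"
      by (rule sum.swap)
    also have "\<dots> = (\<Sum>k\<in>I. \<Sum>l\<in>I. \<Sum>i\<in>UNIV. c k * cnj (c l) * e_fun (p k - p l) (a $ i))"
      by (intro sum.cong refl sum.swap)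
    finally show ?thesis
      by (simp add: sum_distrib_left)
  qed
  let ?v = "\<Sum>k\<in>I. c k *s e_vec (p k) \<beta>"
  have "(\<Sum>i\<in>UNIV. ?v $ i * cnj (?v $ i)) = 0"
  proof -
    have "(\<Sum>i\<in>UNIV. ?v $ i * cnj (?v $ i)) = ?L \<alpha>"
      unfolding gram using I by (auto simp: image_subset_iff intro!: sum.cong spectrum_gram_eq[OF ord spec])
    then show ?thesis
      unfolding rel by simp
  qed
  then have "complex_of_real (\<Sum>i\<in>UNIV. (cmod (?v $ i))\<^sup>2) = 0"
    by (simp only: complex_norm_square of_real_sum)
  then have "(\<Sum>i\<in>UNIV. (cmod (?v $ i))\<^sup>2) = 0"
    by (simp only: of_real_eq_0_iff)
  then have "\<forall>i. ?v $ i = 0"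
    by (subst (asm) sum_nonneg_eq_0_iff) auto
  then show ?thesis
    by (simp add: vec_eq_iff)
qed

text \<open>Prescribe a linear map on a maximal independent set of vectors
  \<open>e_vec \<xi> \<alpha>\<close>. The remaining vectors depend linearly on these, and
  \<open>boundary_relation\<close> transfers the dependence to \<open>\<beta>\<close>. This supplies
  a matrix for the gap formula, whose statement mentions none.\<close>

lemma boundary_map_exists:
  fixes \<alpha> \<beta> :: "real^('n::{finite,linorder})"
  assumes ord: "ordered_endpoints \<alpha> \<beta>" and spec: "is_spectrum (Omega \<alpha> \<beta>) \<Lambda>"
  obtains B where "\<And>\<xi>. \<xi> \<in> \<Lambda> \<Longrightarrow> B *v e_vec \<xi> \<alpha> = e_vec \<xi> \<beta>"
proof -
  obtain V where V: "V \<subseteq> (\<lambda>\<xi>. e_vec \<xi> \<alpha>) ` \<Lambda>" "vec.independent V"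
      "(\<lambda>\<xi>. e_vec \<xi> \<alpha>) ` \<Lambda> \<subseteq> vec.span V"
    using vec.maximal_independent_subset by blast
  have "finite V"
    using V(2) by (rule vec.finiteI_independent)
  have "\<forall>v\<in>V. \<exists>\<xi>. \<xi> \<in> \<Lambda> \<and> v = e_vec \<xi> \<alpha>"
    using V(1) by auto
  then obtain p where p: "\<And>v. v \<in> V \<Longrightarrow> p v \<in> \<Lambda> \<and> v = e_vec (p v) \<alpha>"
    by metis
  obtain f where f: "Vector_Spaces.linear (*s) (*s) f" "\<And>v. v \<in> V \<Longrightarrow> f v = e_vec (p v) \<beta>"
    using vec.linear_independent_extend[OF V(2), of "\<lambda>v. e_vec (p v) \<beta>"] by auto
  have "matrix f *v e_vec \<xi> \<alpha> = e_vec \<xi> \<beta>" if "\<xi> \<in> \<Lambda>" for \<xi>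
  proof -
    have "e_vec \<xi> \<alpha> \<in> vec.span V"
      using V(3) that by auto
    then obtain u where u: "e_vec \<xi> \<alpha> = (\<Sum>v\<in>V. u v *s v)"
      using \<open>finite V\<close> by (auto simp: vec.span_finite)
    \<comment> \<open>The index \<open>None\<close> stands for \<open>\<xi>\<close> itself and
      \<open>Some v\<close> for a basis vector. The tags keep the two apart even if
      \<open>e_vec \<xi> \<alpha>\<close> belongs to \<open>V\<close>.\<close>
    define c where "c = case_option (-1) u"
    define q where "q = case_option \<xi> p"
    have sum: "(\<Sum>k\<in>insert None (Some ` V). c k *s e_vec (q k) a) =
        - e_vec \<xi> a + (\<Sum>v\<in>V. u v *s e_vec (p v) a)" for a
      using \<open>finite V\<close> by (subst sum.insert) (auto simp: c_def q_def sum.reindex)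
    have "(\<Sum>v\<in>V. u v *s e_vec (p v) \<alpha>) = e_vec \<xi> \<alpha>"
      unfolding u using p by (intro sum.cong) auto
    then have "(\<Sum>k\<in>insert None (Some ` V). c k *s e_vec (q k) \<beta>) = 0"
    proof (intro boundary_relation[OF ord spec])
      show "q ` insert None (Some ` V) \<subseteq> \<Lambda>"
        using p that by (auto simp: q_def)
    qed (simp add: sum)
    then have "e_vec \<xi> \<beta> = (\<Sum>v\<in>V. u v *s e_vec (p v) \<beta>)"
      by (simp add: sum)
    also have "\<dots> = f (e_vec \<xi> \<alpha>)"
      unfolding u using f by (simp add: vec.linear_sum[OF f(1)] vec.linear_scale[OF f(1)])
    finally show ?thesis
      using matrix_works[OF f(1)] by simp
  qed
  then show ?thesis
    by (rule that)
qed


subsection \<open>Expansion along admissible paths\<close>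

text \<open>The possible continuations \<open>i\<^sub>2\<dots>i\<^sub>m\<close> of an admissible path, \<open>u\<close> being the time left
  after leaving the first interval; \<open>l\<close> gives the interval lengths.\<close>

definition tails :: "('a \<Rightarrow> real) \<Rightarrow> real \<Rightarrow> 'a list set" where
  "tails l u = {v. v \<noteq> [] \<and> (\<Sum>k\<leftarrow>butlast v. l k) \<le> u \<and> u < (\<Sum>k\<leftarrow>v. l k)}"

text \<open>Split by the first interval \<open>k\<close> that is entered. If \<open>u < l k\<close>,
  the time runs out inside it, and positivity of the lengths excludes further letters; otherwise
  \<open>l k\<close> is used up and time \<open>u - l k\<close> remains.\<close>

lemma tails_rec:
  assumes pos: "\<And>k. 0 < l k" and u: "0 \<le> u"
  shows "tails l u = (\<Union>k. if u < l k then {[k]} else Cons k ` tails l (u - l k))"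
proof -
  have nonneg: "0 \<le> (\<Sum>k\<leftarrow>v. l k)" for v
    by (intro sum_list_nonneg) (auto simp: less_imp_le[OF pos])
  have "k # w \<in> tails l u \<longleftrightarrow> (if u < l k then w = [] else w \<in> tails l (u - l k))" for k w
    using u nonneg[of "butlast w"] by (auto simp: tails_def)
  moreover have "[] \<notin> tails l u"
    by (simp add: tails_def)
  ultimately show ?thesis
    by (intro set_eqI, rename_tac v, case_tac v) (auto split: if_splits)
qed

lemma sum_list_butlast_last:
  fixes l :: "'a \<Rightarrow> real"
  shows "v \<noteq> [] \<Longrightarrow> (\<Sum>k\<leftarrow>v. l k) = (\<Sum>k\<leftarrow>butlast v. l k) + l (last v)"
  by (induction v rule: rev_induct) auto

lemma path_prod_Cons: "w \<noteq> [] \<Longrightarrow> path_prod M (i # w) = M $ i $ hd w * path_prod M w"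
  by (cases w) (auto simp: path_prod_def)

text \<open>By multiplicativity and the relation \<open>M\<close>, \<open>E (b i + u)\<close> is the
  sum of \<open>M $ i $ k * E (a k + u)\<close>. If \<open>u < l k\<close>, the path stops in
  interval \<open>k\<close>; otherwise \<open>a k + u = b k + (u - l k)\<close>, and the argument
  repeats with less time. Keeping \<open>a\<close>, \<open>b\<close>, \<open>E\<close> and
  \<open>M\<close> abstract lets both directions of time use it.\<close>

lemma path_expansion:
  fixes a b :: "('n::finite) \<Rightarrow> real" and E :: "real \<Rightarrow> complex"
  assumes ab: "\<And>k. a k < b k" and E: "\<And>x y. E (x + y) = E x * E y"
    and M: "\<And>i. E (b i) = (\<Sum>k\<in>UNIV. M $ i $ k * E (a k))" and u: "0 \<le> u"
  defines "l \<equiv> \<lambda>k. b k - a k"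
  shows "finite (tails l u)"
    and "E (b i + u) = (\<Sum>v\<in>tails l u. path_prod M (i # v) * E (a (last v) + (u - (\<Sum>k\<leftarrow>butlast v. l k))))"
proof -
  have pos: "0 < l k" for k
    using ab by (simp add: l_def)
  \<comment> \<open>Each crossing uses up at least \<open>m\<close>, so induction on a bound
    \<open>N\<close> with \<open>u < real N * m\<close> terminates; its base case is
    vacuous.\<close>
  define m where "m = Min (range l)"
  have m: "0 < m" "m \<le> l k" for k
    unfolding m_def using pos by auto
  define T where "T v u = E (a (last v) + (u - (\<Sum>k\<leftarrow>butlast v. l k)))" for v u
  have "finite (tails l u) \<and> (\<forall>i. E (b i + u) = (\<Sum>v\<in>tails l u. path_prod M (i # v) * T v u))"
    if "0 \<le> u" "u < real N * m" for N u
    using that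
  proof (induction N arbitrary: u)
    case (Suc N)
    \<comment> \<open>The tails that begin with \<open>k\<close>, as described by
      \<open>tails_rec\<close>.\<close>
    define X where "X k = (if u < l k then {[k]} else Cons k ` tails l (u - l k))" for k
    have IH: "finite (tails l (u - l k))"
      "E (b i + (u - l k)) = (\<Sum>v\<in>tails l (u - l k). path_prod M (i # v) * T v (u - l k))"
      if "\<not> u < l k" for k i
    proof -
      have "u - l k < real N * m"
        using Suc.prems m(2)[of k] by (simp add: algebra_simps)
      then show "finite (tails l (u - l k))"
        "E (b i + (u - l k)) = (\<Sum>v\<in>tails l (u - l k). path_prod M (i # v) * T v (u - l k))"
        using Suc.IH[of "u - l k"] that by auto
    qed
    have X: "tails l u = (\<Union>k. X k)"
      unfolding X_def by (intro tails_rec pos Suc.prems)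
    have fin: "finite (X k)" for k
      using IH(1) by (auto simp: X_def)
    have disj: "X j \<inter> X k = {}" if "j \<noteq> k" for j k
      using that by (auto simp: X_def split: if_splits)
    have step: "(\<Sum>v\<in>X k. path_prod M (i # v) * T v u) = M $ i $ k * E (a k + u)" for i k
    proof (cases "u < l k")
      case True
      then show ?thesis
        by (simp add: X_def T_def path_prod_def)
    next
      case False
      have nonempty: "w \<noteq> []" if "w \<in> tails l (u - l k)" for w
        using that by (auto simp: tails_def)
      have "(\<Sum>v\<in>X k. path_prod M (i # v) * T v u) =
          (\<Sum>w\<in>tails l (u - l k). path_prod M (i # k # w) * T (k # w) u)"
        using False by (simp add: X_def sum.reindex)
      \<comment> \<open>For nonempty \<open>w\<close>, prefixing \<open>k\<close> keeps the last
        letter and adds \<open>l k\<close> to the inner length, so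
        \<open>T (k # w) u = T w (u - l k)\<close>.\<close>
      also have "\<dots> = (\<Sum>w\<in>tails l (u - l k). M $ i $ k * (path_prod M (k # w) * T w (u - l k)))"
        using nonempty by (intro sum.cong) (auto simp: path_prod_Cons T_def algebra_simps)
      also have "\<dots> = M $ i $ k * E (b k + (u - l k))"
        using IH(2)[OF False, of k] by (simp add: sum_distrib_left)
      finally show ?thesis
        by (simp add: l_def add.commute)
    qed
    have "E (b i + u) = (\<Sum>v\<in>tails l u. path_prod M (i # v) * T v u)" for i
    proof -
      have "E (b i + u) = (\<Sum>k\<in>UNIV. M $ i $ k * E (a k + u))"
        by (simp add: E M sum_distrib_right mult.assoc)
      also have "\<dots> = (\<Sum>k\<in>UNIV. \<Sum>v\<in>X k. path_prod M (i # v) * T v u)"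
        by (simp add: step)
      also have "\<dots> = (\<Sum>v\<in>tails l u. path_prod M (i # v) * T v u)"
        unfolding X using fin disj by (intro sum.UNION_disjoint[symmetric]) auto
      finally show ?thesis .
    qed
    then show ?case
      using X fin by auto
  qed simp
  moreover obtain N where "u < real N * m"
    using reals_Archimedean3 m(1) by blast
  ultimately show "finite (tails l u)"
    "E (b i + u) = (\<Sum>v\<in>tails l u. path_prod M (i # v) * E (a (last v) + (u - (\<Sum>k\<leftarrow>butlast v. l k))))"
    using u by (auto simp: T_def)
qed

section \<open>Path sets and the expansion of exponentials over them\<close>

lemma paths_eq:
  assumes ord: "ordered_endpoints \<alpha> \<beta>" and x: "x \<in> {\<alpha> $ i<..<\<beta> $ i}"
  shows paths_pos_short: "0 < t \<Longrightarrow> t < \<beta> $ i - x \<Longrightarrow> paths \<alpha> \<beta> x t = {[i]}"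
    and paths_pos_long: "0 < t \<Longrightarrow> \<beta> $ i - x \<le> t \<Longrightarrow>
      paths \<alpha> \<beta> x t = Cons i ` tails (len \<alpha> \<beta>) (t - (\<beta> $ i - x))"
    and paths_neg_short: "t \<le> 0 \<Longrightarrow> \<alpha> $ i - x < t \<Longrightarrow> paths \<alpha> \<beta> x t = {[i]}"
    and paths_neg_long: "t \<le> 0 \<Longrightarrow> t \<le> \<alpha> $ i - x \<Longrightarrow>
      paths \<alpha> \<beta> x t = Cons i ` tails (len \<alpha> \<beta>) (\<alpha> $ i - x - t)"
proof -
  \<comment> \<open>Only interval \<open>i\<close> contains \<open>x\<close>, so every admissible
    path starts with \<open>i\<close> and the remaining conditions concern its tail alone.\<close>
  have hd: "x \<in> {\<alpha> $ k<..<\<beta> $ k} \<longleftrightarrow> k = i" for k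
    using interval_index_unique[OF ord, of x k i] x by auto
  have iff: "\<omega> \<in> paths \<alpha> \<beta> x t \<longleftrightarrow> \<omega> \<noteq> [] \<and> hd \<omega> = i \<and>
      (if 0 < t then
         if t < \<beta> $ i - x then tl \<omega> = [] else tl \<omega> \<in> tails (len \<alpha> \<beta>) (t - (\<beta> $ i - x))
       else if \<alpha> $ i - x < t then tl \<omega> = [] else tl \<omega> \<in> tails (len \<alpha> \<beta>) (\<alpha> $ i - x - t))" for \<omega>
    unfolding paths_def mem_Collect_eq admissible_def hd
    by (cases \<omega>; cases "tl \<omega>")
       (auto simp: tails_def inner_len_def sum_list_butlast_last simp del: butlast.simps list.map(2))
  show "0 < t \<Longrightarrow> t < \<beta> $ i - x \<Longrightarrow> paths \<alpha> \<beta> x t = {[i]}"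
    "t \<le> 0 \<Longrightarrow> \<alpha> $ i - x < t \<Longrightarrow> paths \<alpha> \<beta> x t = {[i]}"
    by (auto simp: set_eq_iff iff) (metis list.collapse)+
  show "0 < t \<Longrightarrow> \<beta> $ i - x \<le> t \<Longrightarrow>
      paths \<alpha> \<beta> x t = Cons i ` tails (len \<alpha> \<beta>) (t - (\<beta> $ i - x))"
    "t \<le> 0 \<Longrightarrow> t \<le> \<alpha> $ i - x \<Longrightarrow>
      paths \<alpha> \<beta> x t = Cons i ` tails (len \<alpha> \<beta>) (\<alpha> $ i - x - t)"
    by (auto simp: set_eq_iff iff image_iff) (metis list.collapse)+
qed

lemma finite_tails:
  fixes l :: "'a::finite \<Rightarrow> real"
  assumes pos: "\<And>k. 0 < l k" and u: "0 \<le> u"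
  shows "finite (tails l u)"
  \<comment> \<open>The zero function \<open>E\<close> with the zero matrix satisfies the
    hypotheses, and the finiteness claim concerns only the lengths \<open>l\<close>.\<close>
  using path_expansion(1)[of "\<lambda>_. 0" l "\<lambda>_. 0" 0 u] assms by simp

lemma finite_paths:
  assumes ord: "ordered_endpoints \<alpha> \<beta>"
  shows "finite (paths \<alpha> \<beta> x t)"
proof (cases "\<exists>i. x \<in> {\<alpha> $ i<..<\<beta> $ i}")
  case True
  then obtain i where x: "x \<in> {\<alpha> $ i<..<\<beta> $ i}" ..
  have "finite (tails (len \<alpha> \<beta>) u)" if "0 \<le> u" for u
    using ord that by (intro finite_tails) (auto simp: len_def ordered_endpoints_def)
  then show ?thesis
    using paths_eq[OF ord x, of t]
    by (cases "0 < t"; cases "t < \<beta> $ i - x"; cases "\<alpha> $ i - x < t") auto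
next
  case False
  then have "paths \<alpha> \<beta> x t = {}"
    by (auto simp: paths_def admissible_def)
  then show ?thesis
    by simp
qed

text \<open>If \<open>t\<close> is too short to leave interval \<open>i\<close>, the only path has
  weight 1 and end \<open>x + t\<close>. Otherwise \<open>path_expansion\<close> starts at the right
  endpoint with the time \<open>u\<close> that is left on arrival there.\<close>

lemma e_fun_expansion_pos:
  assumes ord: "ordered_endpoints \<alpha> \<beta>" and x: "x \<in> {\<alpha> $ i<..<\<beta> $ i}" and t: "0 < t"
    and B: "B *v e_vec \<xi> \<alpha> = e_vec \<xi> \<beta>"
  shows "e_fun \<xi> (x + t) = (\<Sum>\<omega>\<in>paths \<alpha> \<beta> x t. path_weight B t \<omega> * e_fun \<xi> (path_end \<alpha> \<beta> x t \<omega>))"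
proof (cases "t < \<beta> $ i - x")
  case True
  then show ?thesis
    using t by (simp add: paths_pos_short[OF ord x] path_weight_def path_prod_def path_end_def)
next
  case False
  define u where "u = t - (\<beta> $ i - x)"
  have ab: "\<alpha> $ k < \<beta> $ k" for k
    using ord by (simp add: ordered_endpoints_def)
  have Brow: "e_fun \<xi> (\<beta> $ i) = (\<Sum>k\<in>UNIV. B $ i $ k * e_fun \<xi> (\<alpha> $ k))" for i
    using B by (simp add: vec_eq_iff matrix_vector_mult_def e_vec_def)
  have u: "0 \<le> u"
    using False by (simp add: u_def)
  have len: "(\<lambda>k. \<beta> $ k - \<alpha> $ k) = len \<alpha> \<beta>"
    by (auto simp: len_def)
  have paths: "paths \<alpha> \<beta> x t = Cons i ` tails (len \<alpha> \<beta>) u"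
    using False t by (simp add: paths_pos_long[OF ord x] u_def)
  note expansion = path_expansion(2)[of "\<lambda>k. \<alpha> $ k" "\<lambda>k. \<beta> $ k" "e_fun \<xi>" B u,
      OF ab e_fun_add Brow u, unfolded len]
  have "e_fun \<xi> (x + t) = e_fun \<xi> (\<beta> $ i + u)"
    by (simp add: u_def add.commute)
  also have "\<dots> = (\<Sum>\<omega>\<in>paths \<alpha> \<beta> x t. path_weight B t \<omega> * e_fun \<xi> (path_end \<alpha> \<beta> x t \<omega>))"
    unfolding paths expansion
    using t by (auto simp: sum.reindex tails_def path_weight_def path_end_def remainder_def
        inner_len_def u_def diff_diff_eq intro!: sum.cong)
  finally show ?thesis .
qed

text \<open>The case \<open>t \<le> 0\<close> is the reflection \<open>y \<mapsto> -y\<close> of the case \<open>t > 0\<close>, with the roles of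
  \<open>\<alpha>\<close> and \<open>\<beta>\<close> exchanged.\<close>

lemma e_fun_expansion_neg:
  assumes ord: "ordered_endpoints \<alpha> \<beta>" and x: "x \<in> {\<alpha> $ i<..<\<beta> $ i}" and t: "t \<le> 0"
    and B: "mat_adj B *v e_vec \<xi> \<beta> = e_vec \<xi> \<alpha>"
  shows "e_fun \<xi> (x + t) = (\<Sum>\<omega>\<in>paths \<alpha> \<beta> x t. path_weight B t \<omega> * e_fun \<xi> (path_end \<alpha> \<beta> x t \<omega>))"
proof (cases "\<alpha> $ i - x < t")
  case True
  then show ?thesis
    using t by (simp add: paths_neg_short[OF ord x] path_weight_def path_prod_def path_end_def)
next
  case False
  define u where "u = \<alpha> $ i - x - t"
  have ab: "- \<beta> $ k < - \<alpha> $ k" for k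
    using ord by (simp add: ordered_endpoints_def)
  \<comment> \<open>In the reflected picture the intervals run from \<open>- \<beta> $ k\<close> to
    \<open>- \<alpha> $ k\<close>, and the adjoint plays the part of the boundary matrix.\<close>
  have Brow: "e_fun \<xi> (- (- \<alpha> $ i)) = (\<Sum>k\<in>UNIV. mat_adj B $ i $ k * e_fun \<xi> (- (- \<beta> $ k)))" for i
    using B by (simp add: vec_eq_iff matrix_vector_mult_def e_vec_def)
  have u: "0 \<le> u"
    using False by (simp add: u_def)
  have len: "(\<lambda>k. - \<alpha> $ k - - \<beta> $ k) = len \<alpha> \<beta>"
    by (auto simp: len_def)
  have add: "e_fun \<xi> (- (y + z)) = e_fun \<xi> (- y) * e_fun \<xi> (- z)" for y z
    by (simp flip: e_fun_add)
  have paths: "paths \<alpha> \<beta> x t = Cons i ` tails (len \<alpha> \<beta>) u"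
    using False t by (simp add: paths_neg_long[OF ord x] u_def)
  note expansion = path_expansion(2)[of "\<lambda>k. - \<beta> $ k" "\<lambda>k. - \<alpha> $ k" "\<lambda>y. e_fun \<xi> (- y)" "mat_adj B" u,
      OF ab add Brow u, unfolded len]
  have "e_fun \<xi> (x + t) = e_fun \<xi> (- (- \<alpha> $ i + u))"
    by (simp add: u_def add.commute)
  also have "\<dots> = (\<Sum>\<omega>\<in>paths \<alpha> \<beta> x t. path_weight B t \<omega> * e_fun \<xi> (path_end \<alpha> \<beta> x t \<omega>))"
    unfolding paths expansion
    using t by (auto simp: sum.reindex tails_def path_weight_def path_end_def remainder_def
        inner_len_def u_def algebra_simps intro!: sum.cong)
  finally show ?thesis .
qed

section \<open>Weight sums over paths with a common end\<close>

lemma path_end_mem: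
  assumes \<omega>: "\<omega> \<in> paths \<alpha> \<beta> x t"
  shows path_end_mem_pos: "0 < t \<Longrightarrow> path_end \<alpha> \<beta> x t \<omega> \<in> {\<alpha> $ last \<omega>..<\<beta> $ last \<omega>}"
    and path_end_mem_neg: "t \<le> 0 \<Longrightarrow> path_end \<alpha> \<beta> x t \<omega> \<in> {\<alpha> $ last \<omega><..\<beta> $ last \<omega>}"
proof -
  have [simp]: "last \<omega> = hd \<omega>" if "length \<omega> = Suc 0"
    using that by (cases \<omega>) auto
  show "0 < t \<Longrightarrow> path_end \<alpha> \<beta> x t \<omega> \<in> {\<alpha> $ last \<omega>..<\<beta> $ last \<omega>}"
    "t \<le> 0 \<Longrightarrow> path_end \<alpha> \<beta> x t \<omega> \<in> {\<alpha> $ last \<omega><..\<beta> $ last \<omega>}"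
    using \<omega> by (auto simp: paths_def admissible_def path_end_def remainder_def len_def split: if_splits)
qed

text \<open>Coefficients are compared in \<open>e_fun_expansion_pos\<close>. In positive time a path
  may end at a left endpoint but never at a right one, so small shifts to the right bring all ends
  into \<open>Omega \<alpha> \<beta>\<close>.\<close>

lemma weight_sum_pos:
  assumes ord: "ordered_endpoints \<alpha> \<beta>" and spec: "is_spectrum (Omega \<alpha> \<beta>) \<Lambda>"
    and B: "\<And>\<xi>. \<xi> \<in> \<Lambda> \<Longrightarrow> B *v e_vec \<xi> \<alpha> = e_vec \<xi> \<beta>"
    and x: "x \<in> {\<alpha> $ i<..<\<beta> $ i}" and xt: "x + t \<in> {\<alpha> $ j<..<\<beta> $ j}" and t: "0 < t"
  shows "(\<Sum>\<omega>\<in>{\<omega> \<in> paths \<alpha> \<beta> x t. path_end \<alpha> \<beta> x t \<omega> = e}. path_weight B t \<omega>) =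
    (if e = x + t then 1 else 0)"
proof (rule e_fun_relation_coefficients[OF Omega_open Omega_lmeasurable spec, where F = "at_right 0"])
  have shift: "\<forall>\<^sub>F s in at_right 0. z + s \<in> Omega \<alpha> \<beta>" if "z \<in> {\<alpha> $ k..<\<beta> $ k}" for z k
    unfolding eventually_at_right_field Omega_def
    using that by (intro exI[of _ "\<beta> $ k - z"]) (auto intro!: exI[of _ k])
  show "\<forall>\<^sub>F s in at_right 0. z + s \<in> Omega \<alpha> \<beta>"
    if z: "z \<in> insert (x + t) (path_end \<alpha> \<beta> x t ` paths \<alpha> \<beta> x t)" for z
    using z
  proof
    assume "z = x + t"
    then show ?thesis
      using xt by (intro shift[of _ j]) auto
  next
    assume "z \<in> path_end \<alpha> \<beta> x t ` paths \<alpha> \<beta> x t"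
    then obtain \<omega> where "\<omega> \<in> paths \<alpha> \<beta> x t" "z = path_end \<alpha> \<beta> x t \<omega>"
      by blast
    then show ?thesis
      using shift[OF path_end_mem_pos[OF _ t]] by simp
  qed
qed (use e_fun_expansion_pos[OF ord x t] B finite_paths[OF ord] in auto)

text \<open>As in positive time, but now the possible boundary ends are right endpoints, so the
  shifts go to the left.\<close>

lemma weight_sum_neg:
  assumes ord: "ordered_endpoints \<alpha> \<beta>" and spec: "is_spectrum (Omega \<alpha> \<beta>) \<Lambda>"
    and B: "\<And>\<xi>. \<xi> \<in> \<Lambda> \<Longrightarrow> mat_adj B *v e_vec \<xi> \<beta> = e_vec \<xi> \<alpha>"
    and x: "x \<in> {\<alpha> $ i<..<\<beta> $ i}" and xt: "x + t \<in> {\<alpha> $ j<..<\<beta> $ j}" and t: "t \<le> 0"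
  shows "(\<Sum>\<omega>\<in>{\<omega> \<in> paths \<alpha> \<beta> x t. path_end \<alpha> \<beta> x t \<omega> = e}. path_weight B t \<omega>) =
    (if e = x + t then 1 else 0)"
proof (rule e_fun_relation_coefficients[OF Omega_open Omega_lmeasurable spec, where F = "at_left 0"])
  have shift: "\<forall>\<^sub>F s in at_left 0. z + s \<in> Omega \<alpha> \<beta>" if "z \<in> {\<alpha> $ k<..\<beta> $ k}" for z k
    unfolding eventually_at_left_field Omega_def
    using that by (intro exI[of _ "\<alpha> $ k - z"]) (auto intro!: exI[of _ k])
  show "\<forall>\<^sub>F s in at_left 0. z + s \<in> Omega \<alpha> \<beta>"
    if z: "z \<in> insert (x + t) (path_end \<alpha> \<beta> x t ` paths \<alpha> \<beta> x t)" for z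
    using z
  proof
    assume "z = x + t"
    then show ?thesis
      using xt by (intro shift[of _ j]) auto
  next
    assume "z \<in> path_end \<alpha> \<beta> x t ` paths \<alpha> \<beta> x t"
    then obtain \<omega> where "\<omega> \<in> paths \<alpha> \<beta> x t" "z = path_end \<alpha> \<beta> x t \<omega>"
      by blast
    then show ?thesis
      using shift[OF path_end_mem_neg[OF _ t]] by simp
  qed
qed (use e_fun_expansion_neg[OF ord x t] B finite_paths[OF ord] in auto)

theorem theorem3p1:
  fixes \<alpha> \<beta> :: "real^('n::{finite,linorder})"
  assumes "ordered_endpoints \<alpha> \<beta>"
    and "spectral (Omega \<alpha> \<beta>)"
  shows
    "(\<forall>i j. i \<noteq> j \<and> \<alpha> $ j - \<beta> $ i > 0 \<longrightarrow>
        (\<exists>ks. ks \<noteq> [] \<and> \<alpha> $ j - \<beta> $ i = (\<Sum>k\<leftarrow>ks. len \<alpha> \<beta> k))) \<and>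
     (\<forall>\<Lambda> B. is_spectrum (Omega \<alpha> \<beta>) \<Lambda> \<and> boundary_matrix \<alpha> \<beta> \<Lambda> B \<longrightarrow>
        (\<forall>i j x t. i \<noteq> j \<and> x \<in> {\<alpha> $ i <..< \<beta> $ i} \<and> x + t \<in> {\<alpha> $ j <..< \<beta> $ j} \<longrightarrow>
           (\<Sum>\<omega>\<in>{\<omega> \<in> paths \<alpha> \<beta> x t. path_end \<alpha> \<beta> x t \<omega> = x + t}. path_weight B t \<omega>) = 1 \<and>
           (\<forall>e\<in>Ends \<alpha> \<beta> x t. e \<noteq> x + t \<longrightarrow>
              (\<Sum>\<omega>\<in>{\<omega> \<in> paths \<alpha> \<beta> x t. path_end \<alpha> \<beta> x t \<omega> = e}. path_weight B t \<omega>) = 0)))"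
proof (intro conjI allI impI)
  fix i j :: 'n
  assume ij: "i \<noteq> j \<and> \<alpha> $ j - \<beta> $ i > 0"
  obtain \<Lambda> where spec: "is_spectrum (Omega \<alpha> \<beta>) \<Lambda>"
    using assms(2) by (auto simp: spectral_def)
  obtain B where B: "\<And>\<xi>. \<xi> \<in> \<Lambda> \<Longrightarrow> B *v e_vec \<xi> \<alpha> = e_vec \<xi> \<beta>"
    using boundary_map_exists[OF assms(1) spec] by blast
  have ab: "\<alpha> $ k < \<beta> $ k" for k
    using assms(1) by (simp add: ordered_endpoints_def)
  \<comment> \<open>Any two points of the intervals will do, since they cancel from the gap computed
    below.\<close>
  obtain x y where x: "x \<in> {\<alpha> $ i<..<\<beta> $ i}" and y: "y \<in> {\<alpha> $ j<..<\<beta> $ j}"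
    using dense[OF ab[of i]] dense[OF ab[of j]] by auto
  define t where "t = y - x"
  have xt: "x + t \<in> {\<alpha> $ j<..<\<beta> $ j}" and t: "0 < t" "\<beta> $ i - x \<le> t"
    using x y ij by (auto simp: t_def)
  \<comment> \<open>The weights of the paths ending at \<open>x + t\<close> sum to 1, so at least
    one such path exists.\<close>
  have "(\<Sum>\<omega>\<in>{\<omega> \<in> paths \<alpha> \<beta> x t. path_end \<alpha> \<beta> x t \<omega> = x + t}. path_weight B t \<omega>) \<noteq> 0"
    using weight_sum_pos[OF assms(1) spec B x xt t(1), of "x + t"] by simp
  then obtain \<omega> where \<omega>: "\<omega> \<in> paths \<alpha> \<beta> x t" and endpoint: "path_end \<alpha> \<beta> x t \<omega> = x + t"
    by (metis (mono_tags, lifting) sum.neutral mem_Collect_eq)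
  have last: "last \<omega> = j"
    using path_end_mem_pos[OF \<omega> t(1)] xt unfolding endpoint
    by (intro interval_index_unique[OF assms(1), of "x + t"]) auto
  obtain v where v: "\<omega> = i # v" "v \<noteq> []"
    using \<omega> t by (auto simp: paths_pos_long[OF assms(1) x] tails_def)
  \<comment> \<open>The path ends at \<open>\<alpha> $ j + (t - (\<beta> $ i - x) - inner_len
    \<alpha> \<beta> \<omega>)\<close>; equating this with \<open>x + t\<close> leaves the inner
    length as the gap. As the gap is positive, there is at least one inner letter.\<close>
  have "\<alpha> $ j - \<beta> $ i = (\<Sum>k\<leftarrow>butlast v. len \<alpha> \<beta> k)"
    using endpoint last t v by (simp add: path_end_def remainder_def inner_len_def)
  with ij show "\<exists>ks. ks \<noteq> [] \<and> \<alpha> $ j - \<beta> $ i = (\<Sum>k\<leftarrow>ks. len \<alpha> \<beta> k)"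
    by (intro exI[of _ "butlast v"]) auto
next
  fix \<Lambda> B i j x t
  assume spec: "is_spectrum (Omega \<alpha> \<beta>) \<Lambda> \<and> boundary_matrix \<alpha> \<beta> \<Lambda> B"
    and x: "i \<noteq> j \<and> x \<in> {\<alpha> $ i<..<\<beta> $ i} \<and> x + t \<in> {\<alpha> $ j<..<\<beta> $ j}"
  have B: "B *v e_vec \<xi> \<alpha> = e_vec \<xi> \<beta>" and Badj: "mat_adj B *v e_vec \<xi> \<beta> = e_vec \<xi> \<alpha>"
    if "\<xi> \<in> \<Lambda>" for \<xi>
  proof -
    show "B *v e_vec \<xi> \<alpha> = e_vec \<xi> \<beta>"
      using spec that by (auto simp: boundary_matrix_def)
    \<comment> \<open>Unitarity inverts the boundary relation, as negative time requires.\<close>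
    then have "mat_adj B *v e_vec \<xi> \<beta> = (mat_adj B ** B) *v e_vec \<xi> \<alpha>"
      by (simp flip: matrix_vector_mul_assoc)
    then show "mat_adj B *v e_vec \<xi> \<beta> = e_vec \<xi> \<alpha>"
      using spec by (simp add: boundary_matrix_def unitary_matrix_def)
  qed
  have weight_sum: "(\<Sum>\<omega>\<in>{\<omega> \<in> paths \<alpha> \<beta> x t. path_end \<alpha> \<beta> x t \<omega> = e}. path_weight B t \<omega>) =
      (if e = x + t then 1 else 0)" for e
    using weight_sum_pos[OF assms(1), of \<Lambda> B x i t j] weight_sum_neg[OF assms(1), of \<Lambda> B x i t j]
      spec x B Badj by (cases "0 < t") auto
  then show "(\<Sum>\<omega>\<in>{\<omega> \<in> paths \<alpha> \<beta> x t. path_end \<alpha> \<beta> x t \<omega> = x + t}. path_weight B t \<omega>) = 1"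
    by simp
  show "\<forall>e\<in>Ends \<alpha> \<beta> x t. e \<noteq> x + t \<longrightarrow>
      (\<Sum>\<omega>\<in>{\<omega> \<in> paths \<alpha> \<beta> x t. path_end \<alpha> \<beta> x t \<omega> = e}. path_weight B t \<omega>) = 0"
    by (simp add: weight_sum)
qed

end
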